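(* Consider the self-adjusting single-source tree problem on a complete binary tree $T$ with $n$ nodes and a set $E$ of $n$ elements, in the setting described in the context. For every finite request sequence $\sigma$ and every offline algorithm $\textsc{Opt}$ that starts from the same initial placement of elements, the expected total cost of \textsc{Random-Push} on $\sigma$ is at most $16$ times the total cost of $\textsc{Opt}$ on $\sigma$. That is, \textsc{Random-Push} is $16$-competitive.
   Context: Problem: $T$ is a complete binary tree; its root $r_T$ has level $0$ and the level $\ell(v)$ of a node is its distance from the root. There is a set $E$ of $n$ elements, and at all times each node holds exactly one element ($\mathrm{nd}(e)$ is the node holding $e$, $\mathrm{el}(v)$ the element at $v$; $\ell(e)=\ell(\mathrm{nd}(e))$). Requests $\sigma=\sigma^1,\sigma^2,\dots$ are elements of $E$, revealed online. Serving a request to $e$ costs $\ell(e)+1$ (access cost); in addition, any swap of the elements at two adjacent nodes (a node and its parent) costs $1$. The total cost of an algorithm is the sum of all access costs and swap costs. The offline algorithm $\textsc{Opt}$ knows the whole sequence and may perform arbitrary swaps of adjacent elements at any time at unit cost each. Augmented push-down $\mathrm{PD}(u,v)$ for two nodes $u,v$ on the same level $d$: let $r_T=v_0,v_1,\dots,v_d=v$ be the root-to-$v$ path; consider the cycle of nodes $v_0\to v_1\to\dots\to v_d\to u\to v_0$ and move each element on a node of this cycle to the next node of the cycle. It is implemented by adjacent swaps as follows: if $u=v$, the element at $v$ is swapped up to the root; otherwise the element $\mathrm{el}(v)$ is swapped up along the path to the root, then swapped down along the root-to-$u$ path to $u$, and finally the element originally at $u$ (now at the parent of $u$) is swapped up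 to the root. The algorithm's cost for a request is its access cost plus the number of these swaps. \textsc{Random-Push}: upon a request to element $e^*$ at level $d^*$, choose a node $v$ uniformly at random among all nodes of level $d^*$ (including $\mathrm{nd}(e^* )$), independently of previous choices, and execute $\mathrm{PD}(\mathrm{nd}(e^* ),v)$. *)

theory Defs
  imports "HOL-Probability.Probability" "HOL-Library.Sublist"
begin

text \<open>
  A node is the list of left/right choices leading to it, listed from the node up to the root.
  Hence \<open>[]\<close> is the root, the level of a node is its length, the parent of \<open>v \<noteq> []\<close> is \<open>tl v\<close>,
  and the nodes on the path from \<open>v\<close> to the root are the suffixes of \<open>v\<close>.
\<close>
type_synonym node = "bool list"

definition tree_nodes :: "nat \<Rightarrow> node set" where
  "tree_nodes h = {v. length v \<le> h}"

definition level_nodes :: "nat \<Rightarrow> nat \<Rightarrow> node set" where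
  "level_nodes h d = {v \<in> tree_nodes h. length v = d}"

text \<open>
  A placement is a function \<open>el\<close> from nodes to elements; it is meaningful when it is a bijection
  from \<open>tree_nodes h\<close> onto the set of elements.
\<close>
definition nd :: "nat \<Rightarrow> (node \<Rightarrow> 'e) \<Rightarrow> 'e \<Rightarrow> node" where
  "nd h el e = inv_into (tree_nodes h) el e"

definition level :: "nat \<Rightarrow> (node \<Rightarrow> 'e) \<Rightarrow> 'e \<Rightarrow> nat" where
  "level h el e = length (nd h el e)"

definition swap_parent :: "node \<Rightarrow> (node \<Rightarrow> 'e) \<Rightarrow> (node \<Rightarrow> 'e)" where
  "swap_parent v el = el(v := el (tl v), tl v := el v)"

datatype 'e event = Swap node | Serve 'e

fun event_cost :: "nat \<Rightarrow> (node \<Rightarrow> 'e) \<Rightarrow> 'e event \<Rightarrow> nat" where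
  "event_cost h el (Swap v) = 1"
| "event_cost h el (Serve e) = level h el e + 1"

fun event_step :: "'e event \<Rightarrow> (node \<Rightarrow> 'e) \<Rightarrow> (node \<Rightarrow> 'e)" where
  "event_step (Swap v) el = swap_parent v el"
| "event_step (Serve e) el = el"

primrec total_cost :: "nat \<Rightarrow> (node \<Rightarrow> 'e) \<Rightarrow> 'e event list \<Rightarrow> nat" where
  "total_cost h el [] = 0"
| "total_cost h el (a # as) = event_cost h el a + total_cost h (event_step a el) as"

primrec served :: "'e event list \<Rightarrow> 'e list" where
  "served [] = []"
| "served (a # as) = (case a of Swap v \<Rightarrow> served as | Serve e \<Rightarrow> e # served as)"

text \<open>
  Every run of an offline algorithm: the requests are served in the given order, and arbitrarily
  many swaps along tree edges may happen before, between and after them.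
\<close>
definition offline_run :: "nat \<Rightarrow> 'e list \<Rightarrow> 'e event list \<Rightarrow> bool" where
  "offline_run h \<sigma> as \<longleftrightarrow>
     served as = \<sigma> \<and> (\<forall>v. Swap v \<in> set as \<longrightarrow> v \<in> tree_nodes h \<and> v \<noteq> [])"

text \<open>
  The edges used, in this order, when the element at \<open>v\<close> is swapped up to the root; the reversed
  list swaps the element at the root down to \<open>v\<close>.
\<close>
primrec up_swaps :: "node \<Rightarrow> node list" where
  "up_swaps [] = []"
| "up_swaps (b # p) = (b # p) # up_swaps p"

definition pd_swaps :: "node \<Rightarrow> node \<Rightarrow> node list" where
  "pd_swaps u v =
     (if u = v then up_swaps v else up_swaps v @ rev (up_swaps u) @ up_swaps (tl u))"

definition push_down :: "node \<Rightarrow> node \<Rightarrow> (node \<Rightarrow> 'e) \<Rightarrow> (node \<Rightarrow> 'e)" where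
  "push_down u v el = fold swap_parent (pd_swaps u v) el"

text \<open>
  The distribution of the event sequence produced by Random-Push; the access cost of a request is
  charged before its push-down is executed.
\<close>
primrec random_push :: "nat \<Rightarrow> (node \<Rightarrow> 'e) \<Rightarrow> 'e list \<Rightarrow> 'e event list pmf" where
  "random_push h el [] = return_pmf []"
| "random_push h el (e # \<sigma>) =
     bind_pmf (pmf_of_set (level_nodes h (level h el e))) (\<lambda>v.
       map_pmf (\<lambda>as. Serve e # map Swap (pd_swaps (nd h el e) v) @ as)
         (random_push h (push_down (nd h el e) v el) \<sigma>))"


text \<open>
  The swaps of \<open>pd_swaps u v\<close> carry out the cyclic shift
  root \<open>\<rightarrow> \<dots> \<rightarrow> v \<rightarrow> u \<rightarrow>\<close> root that defines the augmented push-down.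
\<close>

lemma swap_parent_apply:
  "swap_parent v el w = (if w = tl v then el v else if w = v then el (tl v) else el w)"
  by (simp add: swap_parent_def)

lemma fold_up_swaps:
  "fold swap_parent (up_swaps v) el w =
     (if w = [] then el v else if suffix w v then el (tl w) else el w)"
proof (induction v arbitrary: el)
  case Nil
  then show ?case by auto
next
  case (Cons b p)
  have *: "\<not> suffix (b # p) p"
    using suffix_length_le[of "b # p" p] by auto
  have **: "tl w \<noteq> b # p \<and> tl w \<noteq> p" if "suffix w p" "w \<noteq> []"
    using suffix_length_le[OF that(1)] that(2) by (cases w) auto
  have "fold swap_parent (up_swaps (b # p)) el w =
      (if w = [] then swap_parent (b # p) el p
       else if suffix w p then swap_parent (b # p) el (tl w)
       else swap_parent (b # p) el w)"
    by (simp add: Cons.IH)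
  also have "\<dots> = (if w = [] then el (b # p) else if suffix w (b # p) then el (tl w) else el w)"
    using * ** by (auto simp: swap_parent_apply suffix_Cons)
  finally show ?case .
qed

lemma swap_parent_swap_parent: "swap_parent v (swap_parent v el) = el"
  by (auto simp: swap_parent_def fun_eq_iff)

lemma fold_swaps_rev: "fold swap_parent vs (fold swap_parent (rev vs) el) = el"
  by (induction vs arbitrary: el) (simp_all add: swap_parent_swap_parent)

lemma push_down_cycle:
  assumes "length u = length v"
  shows "push_down u v el w =
    (if w = [] then el u
     else if suffix w v then el (tl w)
     else if w = u then el v
     else el w)"
proof (cases "u = v")
  case True
  then show ?thesis by (auto simp: push_down_def pd_swaps_def fold_up_swaps)
next
  case False
  then obtain b p where u: "u = b # p" using assms by (cases u) auto
  have nsuf: "\<not> suffix u v"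
    using assms False by (auto simp: suffix_def)
  have nsuf': "\<not> suffix u p"
    using suffix_length_le[of u p] u by auto
  define el1 where "el1 = fold swap_parent (up_swaps v) el"
  define el2 where "el2 = fold swap_parent (rev (up_swaps p)) el1"
  have el1: "el1 w = fold swap_parent (up_swaps p) el2 w" for w
    by (simp add: el2_def fold_swaps_rev)
  have "push_down u v el w = fold swap_parent (up_swaps p) (swap_parent u el2) w"
    using False by (simp add: push_down_def pd_swaps_def u el1_def el2_def)
  also have "\<dots> = (if w = [] then el1 u else if w = u then el1 [] else el1 w)"
  proof -
    have "tl w \<noteq> u \<and> tl w \<noteq> p" if "suffix w p" "w \<noteq> []"
      using suffix_length_le[OF that(1)] that(2) u by (cases w) auto
    then show ?thesis
      using nsuf' by (auto simp: el1 fold_up_swaps swap_parent_apply u)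
  qed
  also have "\<dots> = (if w = [] then el u else if suffix w v then el (tl w)
      else if w = u then el v else el w)"
    using nsuf u by (auto simp: el1_def fold_up_swaps)
  finally show ?thesis .
qed

end

theory Submission
  imports Defs
begin

text \<open>
  Let the potential be the sum over all elements \<open>x\<close> of \<open>max 0 (\<ell>(x) - \<ell>\<^sub>O\<^sub>P\<^sub>T(x) - 2)\<close>, weighted
  by \<open>8\<close>. An offline swap raises one element by one level, hence the potential by at most \<open>8\<close>.
  Serving an element at level \<open>d\<close>, which is at level \<open>k\<close> in the offline tree, costs at most \<open>4 * d\<close>
  (or \<open>1\<close> if \<open>d = 0\<close>) and removes the contribution \<open>8 * max 0 (d - k - 2)\<close> of that element, while
  the elements pushed down add at most \<open>4 * max 0 (d - 2)\<close> in expectation. The sum is at most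
  \<open>8 * (k + 1)\<close>, so that the ratio is even \<open>8\<close>.
\<close>

section \<open>Counting nodes of the complete binary tree\<close>

lemma finite_tree_nodes: "finite (tree_nodes h)"
proof -
  have "tree_nodes h = {v. set v \<subseteq> (UNIV :: bool set) \<and> length v \<le> h}"
    by (auto simp: tree_nodes_def)
  then show ?thesis
    using finite_lists_length_le[of "UNIV :: bool set" h] by simp
qed

lemma card_tree_nodes: "card (tree_nodes h) + 1 = 2 ^ (h + 1)"
proof -
  have "tree_nodes h = {v. set v \<subseteq> (UNIV :: bool set) \<and> length v \<le> h}"
    by (auto simp: tree_nodes_def)
  then have "card (tree_nodes h) = (\<Sum>i\<le>h. 2 ^ i)"
    using card_lists_length_le[of "UNIV :: bool set" h] by simp
  moreover have "(\<Sum>i\<le>h. 2 ^ i) + 1 = (2 :: nat) ^ (h + 1)"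
    by (induction h) auto
  ultimately show ?thesis by simp
qed

lemma card_node_length: "card {v :: node. length v = d} = 2 ^ d"
  using card_lists_length_eq[of "UNIV :: bool set" d] by simp

lemma finite_node_length: "finite {v :: node. length v = d}"
  using finite_lists_length_eq[of "UNIV :: bool set" d] by simp

lemma level_nodes_eq: "d \<le> h \<Longrightarrow> level_nodes h d = {v. length v = d}"
  by (auto simp: level_nodes_def tree_nodes_def)

text \<open>Such a \<open>v\<close> is \<open>w\<close> preceded by \<open>d - length w\<close> free
  choices. For \<open>d < length w\<close> the set is empty and the truncated exponent gives the
  valid bound 1.\<close>

lemma card_level_descendants_le:
  "card {v :: node. length v = d \<and> suffix w v} \<le> 2 ^ (d - length w)"
proof -
  have "{v :: node. length v = d \<and> suffix w v} \<subseteq> (\<lambda>q. q @ w) ` {q. length q = d - length w}"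
    by (auto simp: suffix_def)
  then have "card {v :: node. length v = d \<and> suffix w v}
      \<le> card ((\<lambda>q. q @ w) ` {q :: node. length q = d - length w})"
    by (intro card_mono finite_imageI finite_node_length)
  also have "\<dots> \<le> 2 ^ (d - length w)"
    using card_image_le[OF finite_node_length, of "\<lambda>q. q @ w"] by (simp add: card_node_length)
  finally show ?thesis .
qed

section \<open>Placements as bijections and the levels of elements\<close>

lemma nd_in_tree_nodes:
  "bij_betw el (tree_nodes h) E \<Longrightarrow> x \<in> E \<Longrightarrow> nd h el x \<in> tree_nodes h"
  unfolding nd_def by (metis bij_betw_def inv_into_into)

lemma el_nd: "bij_betw el (tree_nodes h) E \<Longrightarrow> x \<in> E \<Longrightarrow> el (nd h el x) = x"
  unfolding nd_def by (metis bij_betw_def f_inv_into_f)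

lemma nd_el: "bij_betw el (tree_nodes h) E \<Longrightarrow> w \<in> tree_nodes h \<Longrightarrow> nd h el (el w) = w"
  unfolding nd_def by (metis bij_betw_def inv_into_f_f)

lemma level_le: "bij_betw el (tree_nodes h) E \<Longrightarrow> x \<in> E \<Longrightarrow> level h el x \<le> h"
  using nd_in_tree_nodes[of el h E x] by (simp add: level_def tree_nodes_def)

lemma level_eqI:
  "bij_betw el (tree_nodes h) E \<Longrightarrow> w \<in> tree_nodes h \<Longrightarrow> el w = x \<Longrightarrow> level h el x = length w"
  unfolding level_def by (metis nd_el)

lemma card_level_le:
  assumes "bij_betw el (tree_nodes h) E"
  shows "card {x \<in> E. level h el x \<le> j} \<le> 2 ^ (j + 1)"
proof -
  have "{x \<in> E. level h el x \<le> j} \<subseteq> el ` tree_nodes j"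
    using el_nd[OF assms] by (force simp: level_def tree_nodes_def)
  then have "card {x \<in> E. level h el x \<le> j} \<le> card (el ` tree_nodes j)"
    by (intro card_mono finite_imageI finite_tree_nodes)
  also have "\<dots> \<le> card (tree_nodes j)"
    by (intro card_image_le finite_tree_nodes)
  finally show ?thesis
    using card_tree_nodes[of j] by linarith
qed

section \<open>Effect of swaps and push-downs on a placement\<close>

lemma bij_betw_swap_parent:
  assumes "bij_betw el (tree_nodes h) E" and "v \<in> tree_nodes h"
  shows "bij_betw (swap_parent v el) (tree_nodes h) E"
proof -
  have tl: "tl v \<in> tree_nodes h"
    using assms(2) by (auto simp: tree_nodes_def)
  \<comment> \<open>A swap is precomposition with a transposition; at the root,
    \<open>tl [] = []\<close> turns the latter into the identity.\<close>
  have "swap_parent v el = el \<circ> Transposition.transpose v (tl v)"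
    by (auto simp: swap_parent_apply fun_eq_iff Transposition.transpose_def)
  moreover have "bij_betw (Transposition.transpose v (tl v)) (tree_nodes h) (tree_nodes h)"
    using assms(2) tl by (intro bij_betwI[where g = "Transposition.transpose v (tl v)"]) (auto simp: Transposition.transpose_def)
  ultimately show ?thesis
    using assms(1) by (metis bij_betw_trans)
qed

lemma bij_betw_fold_swap_parent:
  assumes "bij_betw el (tree_nodes h) E" and "set ps \<subseteq> tree_nodes h"
  shows "bij_betw (fold swap_parent ps el) (tree_nodes h) E"
  using assms by (induction ps arbitrary: el) (auto intro: bij_betw_swap_parent)

lemma set_up_swaps: "set (up_swaps v) \<subseteq> {w. length w \<le> length v}"
  by (induction v) auto

lemma length_up_swaps [simp]: "length (up_swaps v) = length v"
  by (induction v) auto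

lemma set_pd_swaps:
  assumes "length u \<le> h" and "length v \<le> h"
  shows "set (pd_swaps u v) \<subseteq> tree_nodes h"
proof -
  have "set (up_swaps w) \<subseteq> tree_nodes h" if "length w \<le> h" for w
    using set_up_swaps[of w] that by (auto simp: tree_nodes_def)
  from this[of u] this[of v] this[of "tl u"] show ?thesis
    using assms by (simp add: pd_swaps_def)
qed

text \<open>For distinct \<open>u\<close> and \<open>v\<close> on level d the three legs have
  lengths d, d and d - 1; for \<open>u = v\<close> only the first leg remains. At d = 0 the
  truncated bound is 0, and the swap list is indeed empty.\<close>

lemma length_pd_swaps_le: "length u = length v \<Longrightarrow> length (pd_swaps u v) \<le> 3 * length v - 1"
  by (cases v) (auto simp: pd_swaps_def)

lemma bij_betw_push_down:
  assumes "bij_betw el (tree_nodes h) E" and "length u \<le> h" and "length v \<le> h"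
  shows "bij_betw (push_down u v el) (tree_nodes h) E"
  unfolding push_down_def by (intro bij_betw_fold_swap_parent set_pd_swaps assms)

text \<open>Read off from the cycle: only proper ancestors of \<open>v\<close> pass their element
  one level down, while for distinct \<open>u\<close> and \<open>v\<close> the element at
  \<open>v\<close> moves sideways to \<open>u\<close>. Hence the strict suffix.\<close>

lemma level_push_down:
  assumes bij: "bij_betw el (tree_nodes h) E" and len: "length u = length v" and v: "length v \<le> h"
    and x: "x \<in> E"
  shows "level h (push_down u v el) x =
    (if x = el u then 0
     else if strict_suffix (nd h el x) v then level h el x + 1
     else level h el x)"
proof -
  define w where "w = nd h el x"
  have w: "w \<in> tree_nodes h" "el w = x" "level h el x = length w"
    using nd_in_tree_nodes[OF bij x] el_nd[OF bij x] by (simp_all add: w_def level_def)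
  note eqI = level_eqI[OF bij_betw_push_down[OF bij]]
  have u: "length u \<le> h" using len v by simp
  show ?thesis
  proof (cases "w = u")
    case True
    have "level h (push_down u v el) x = length ([] :: node)"
      using True w by (intro eqI u v) (auto simp: tree_nodes_def push_down_cycle[OF len])
    then show ?thesis using True w by simp
  next
    case False
    then have xu: "x \<noteq> el u"
      using w u nd_el[OF bij, of u] nd_el[OF bij, of w] by (auto simp: tree_nodes_def)
    show ?thesis
    proof (cases "strict_suffix w v")
      case True
      then obtain q where q: "v = q @ w" "q \<noteq> []"
        by (auto simp: strict_suffix_def suffix_def)
      \<comment> \<open>Choices are listed upwards, so the last entry of \<open>q\<close> is the one
        made directly below \<open>w\<close>: \<open>last q # w\<close> is the child of
        \<open>w\<close> towards \<open>v\<close>.\<close>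
      have "level h (push_down u v el) x = length (last q # w)"
      proof (intro eqI u v)
        have "length w < length v" using q by simp
        then show "last q # w \<in> tree_nodes h"
          using v by (simp add: tree_nodes_def)
        have "suffix (last q # w) v"
          using q by (metis append_butlast_last_id append.assoc append_Cons append_Nil suffix_def)
        then show "push_down u v el (last q # w) = x"
          using w by (simp add: push_down_cycle[OF len])
      qed
      then show ?thesis using True xu w by (simp add: w_def)
    next
      case nsuf: False
      have "level h (push_down u v el) x = length w"
      proof (cases "w = v")
        case True
        have "u \<noteq> []" and "\<not> suffix u v"
          using True False len by (auto simp: suffix_def)
        then have "push_down u v el u = x"
          using True w(2) by (simp add: push_down_cycle[OF len])
        then have "level h (push_down u v el) x = length u"
          using u by (intro eqI u v) (simp_all add: tree_nodes_def)
        then show ?thesis using True len by simp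
      next
        case wv: False
        then have "\<not> suffix w v" using nsuf by (simp add: strict_suffix_def)
        then show ?thesis
          using False w by (intro eqI u v) (auto simp: push_down_cycle[OF len])
      qed
      then show ?thesis using nsuf xu w by (simp add: w_def)
    qed
  qed
qed

section \<open>The unweighted potential and its change under one event\<close>

definition potential :: "nat \<Rightarrow> 'e set \<Rightarrow> (node \<Rightarrow> 'e) \<Rightarrow> (node \<Rightarrow> 'e) \<Rightarrow> nat" where
  "potential h E el op = (\<Sum>x\<in>E. level h el x - level h op x - 2)"

text \<open>Only two elements change their offline level: the one moving up adds at most 1, and the
  one moving down can only lower its truncated term.\<close>

lemma potential_swap_parent_le:
  assumes bij: "bij_betw op (tree_nodes h) E" and v: "v \<in> tree_nodes h"
  shows "potential h E el (swap_parent v op) \<le> potential h E el op + 1"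
proof -
  have fin: "finite E"
    using bij finite_tree_nodes bij_betw_finite by blast
  note bij' = bij_betw_swap_parent[OF bij v]
  have tl: "tl v \<in> tree_nodes h"
    using v by (auto simp: tree_nodes_def)
  have le: "level h el x - level h (swap_parent v op) x - 2
      \<le> (level h el x - level h op x - 2) + (if x = op v then 1 else 0)" if x: "x \<in> E" for x
  proof -
    consider "x = op v" | "x \<noteq> op v" "x = op (tl v)" | "x \<noteq> op v" "x \<noteq> op (tl v)" by blast
    then show ?thesis
    proof cases
      case 1
      then have "level h op x = length v" "level h (swap_parent v op) x = length v - 1"
        using level_eqI[OF bij v, of x] level_eqI[OF bij' tl, of x] by (auto simp: swap_parent_apply)
      then show ?thesis using 1 by simp
    next
      case 2
      then have "level h op x = length v - 1" "level h (swap_parent v op) x = length v"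
        using level_eqI[OF bij tl, of x] level_eqI[OF bij' v, of x]
        by (auto simp: swap_parent_apply split: if_splits)
      then show ?thesis by simp
    next
      case 3
      then have "level h (swap_parent v op) x = level h op x"
        using level_eqI[OF bij' nd_in_tree_nodes[OF bij x], of x] el_nd[OF bij x]
        by (metis level_def swap_parent_apply)
      then show ?thesis by simp
    qed
  qed
  have "potential h E el (swap_parent v op)
      \<le> (\<Sum>x\<in>E. (level h el x - level h op x - 2) + (if x = op v then 1 else 0))"
    unfolding potential_def by (rule sum_mono) (rule le)
  also have "\<dots> \<le> potential h E el op + 1"
    using fin by (simp add: sum.distrib potential_def)
  finally show ?thesis .
qed

text \<open>The requested element ends at the root, so its term vanishes; the old term is added on
  the left to avoid a natural subtraction. An element pushed from level i to i + 1 increases its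
  truncated term, by one, exactly when i is at least its offline level plus 2.\<close>

lemma potential_push_down_le:
  assumes bij: "bij_betw el (tree_nodes h) E" and e: "e \<in> E"
    and v: "length v = level h el e"
  shows "potential h E (push_down (nd h el e) v el) op + (level h el e - level h op e - 2)
    \<le> potential h E el op
      + card {x \<in> E. level h op x + 2 \<le> level h el x \<and> strict_suffix (nd h el x) v}"
proof -
  have fin: "finite E"
    using bij finite_tree_nodes bij_betw_finite by blast
  define bad where "bad x \<longleftrightarrow> level h op x + 2 \<le> level h el x \<and> strict_suffix (nd h el x) v" for x
  have len: "length (nd h el e) = length v" using v by (simp add: level_def)
  have "length v \<le> h" using level_le[OF bij e] v by simp
  note lev = level_push_down[OF bij len this, unfolded el_nd[OF bij e]]
  have "potential h E (push_down (nd h el e) v el) op + (level h el e - level h op e - 2)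
      = (\<Sum>x\<in>E. (level h (push_down (nd h el e) v el) x - level h op x - 2)
          + (if x = e then level h el e - level h op e - 2 else 0))"
    using fin e by (simp add: potential_def sum.distrib)
  also have "\<dots> \<le> (\<Sum>x\<in>E. (level h el x - level h op x - 2) + (if bad x then 1 else 0))"
    by (rule sum_mono) (auto simp: lev bad_def)
  also have "\<dots> = potential h E el op + card {x \<in> E. bad x}"
    using fin by (simp add: potential_def sum.distrib sum.If_cases Int_def)
  finally show ?thesis by (simp add: bad_def)
qed

text \<open>
  A level \<open>i \<ge> 2\<close> has \<open>2 ^ i\<close> nodes, but fewer than \<open>2 ^ (i - 1)\<close> elements are at least two
  levels higher in the offline tree; so at most half of the random paths push such an element
  down from level \<open>i\<close>.
\<close>
lemma sum_card_pushed_le: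
  assumes bij: "bij_betw el (tree_nodes h) E" and bij_op: "bij_betw op (tree_nodes h) E"
  shows "2 * (\<Sum>v | length v = d.
      card {x \<in> E. level h op x + 2 \<le> level h el x \<and> strict_suffix (nd h el x) v})
    \<le> (d - 2) * 2 ^ d"
proof -
  have fin: "finite E"
    using bij finite_tree_nodes bij_betw_finite by blast
  define B where "B i = {x \<in> E. level h op x + 2 \<le> i \<and> level h el x = i}" for i
  have "card {x \<in> E. level h op x + 2 \<le> level h el x \<and> strict_suffix (nd h el x) v}
      = (\<Sum>i\<in>{2..<d}. \<Sum>x\<in>B i. if suffix (nd h el x) v then 1 else 0)" if v: "length v = d" for v
  proof -
    have strict: "strict_suffix (nd h el x) v \<longleftrightarrow> suffix (nd h el x) v \<and> level h el x < d" for x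
      using v by (auto simp: strict_suffix_def suffix_def level_def)
    \<comment> \<open>Sorted by current level; the offset 2 rules out levels 0 and 1.\<close>
    have "{x \<in> E. level h op x + 2 \<le> level h el x \<and> strict_suffix (nd h el x) v}
        = (\<Union>i\<in>{2..<d}. {x \<in> B i. suffix (nd h el x) v})"
      by (auto simp: B_def strict)
    also have "card \<dots> = (\<Sum>i\<in>{2..<d}. card {x \<in> B i. suffix (nd h el x) v})"
      by (rule card_UN_disjoint) (use fin in \<open>auto simp: B_def\<close>)
    also have "\<dots> = (\<Sum>i\<in>{2..<d}. \<Sum>x\<in>B i. if suffix (nd h el x) v then 1 else 0)"
      using fin by (simp add: sum.If_cases Int_def B_def)
    finally show ?thesis .
  qed
  then have "(\<Sum>v | length v = d.
        card {x \<in> E. level h op x + 2 \<le> level h el x \<and> strict_suffix (nd h el x) v})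
      = (\<Sum>v | length v = d. \<Sum>i\<in>{2..<d}. \<Sum>x\<in>B i. if suffix (nd h el x) v then 1 else 0)"
    by (intro sum.cong) auto
  also have "\<dots> = (\<Sum>i\<in>{2..<d}. \<Sum>v | length v = d. \<Sum>x\<in>B i. if suffix (nd h el x) v then 1 else 0)"
    by (rule sum.swap)
  \<comment> \<open>Double counting: instead of the counted elements on each path, the paths through
    the node of each such element are summed.\<close>
  also have "\<dots> = (\<Sum>i\<in>{2..<d}. \<Sum>x\<in>B i. \<Sum>v | length v = d. if suffix (nd h el x) v then 1 else 0)"
    by (intro sum.cong refl sum.swap)
  \<comment> \<open>At most \<open>2 ^ (i - 1)\<close> elements, each on at most
    \<open>2 ^ (d - i)\<close> paths: the product does not depend on \<open>i\<close>.\<close>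
  also have "\<dots> \<le> (\<Sum>i\<in>{2..<d}. 2 ^ (d - 1))"
  proof (rule sum_mono)
    fix i assume i: "i \<in> {2..<d}"
    have "(\<Sum>v | length v = d. if suffix (nd h el x) v then 1 else 0) \<le> (2 :: nat) ^ (d - i)"
      if "x \<in> B i" for x
    proof -
      have "(\<Sum>v | length v = d. if suffix (nd h el x) v then 1 else 0)
          = card {v. length v = d \<and> suffix (nd h el x) v}"
        by (simp add: sum.If_cases finite_node_length Int_def)
      also have "\<dots> \<le> 2 ^ (d - length (nd h el x))"
        by (rule card_level_descendants_le)
      finally show ?thesis using that by (simp add: B_def level_def)
    qed
    then have "(\<Sum>x\<in>B i. \<Sum>v | length v = d. if suffix (nd h el x) v then 1 else 0)
        \<le> of_nat (card (B i)) * (2 :: nat) ^ (d - i)"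
      by (rule sum_bounded_above)
    also have "card (B i) \<le> 2 ^ (i - 1)"
    proof -
      have "card (B i) \<le> card {x \<in> E. level h op x \<le> i - 2}"
        using fin by (intro card_mono) (auto simp: B_def)
      also have "\<dots> \<le> 2 ^ (i - 2 + 1)"
        by (rule card_level_le[OF bij_op])
      also have "i - 2 + 1 = i - 1" using i by auto
      finally show ?thesis .
    qed
    then have "of_nat (card (B i)) * (2 :: nat) ^ (d - i) \<le> 2 ^ (i - 1) * 2 ^ (d - i)"
      by simp
    also have "\<dots> = 2 ^ (d - 1)"
      using i by (simp flip: power_add)
    finally show "(\<Sum>x\<in>B i. \<Sum>v | length v = d. if suffix (nd h el x) v then 1 else 0)
        \<le> (2 :: nat) ^ (d - 1)" .
  qed
  also have "\<dots> = (d - 2) * 2 ^ (d - 1)" by simp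
  \<comment> \<open>\<open>2 * 2 ^ (d - 1) = 2 ^ d\<close> fails at \<open>d = 0\<close>, where the
    factor \<open>d - 2\<close> is 0.\<close>
  finally show ?thesis by (cases d) auto
qed

text \<open>The amortised inequality for one request. The average over the \<open>2 ^ d\<close>
  choices of \<open>v\<close> is multiplied out, which keeps everything in the natural
  numbers.\<close>

lemma sum_serve_cost_le:
  assumes bij: "bij_betw el (tree_nodes h) E" and bij_op: "bij_betw op (tree_nodes h) E"
    and e: "e \<in> E" and d: "d = level h el e"
  shows "(\<Sum>v | length v = d. d + 1 + length (pd_swaps (nd h el e) v)
      + 8 * potential h E (push_down (nd h el e) v el) op)
    \<le> 2 ^ d * (8 * (level h op e + 1) + 8 * potential h E el op)"
proof -
  define k where "k = d - level h op e - 2"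
  define P where "P = potential h E el op"
  define c where
    "c v = card {x \<in> E. level h op x + 2 \<le> level h el x \<and> strict_suffix (nd h el x) v}" for v
  \<comment> \<open>Bounds access plus swap cost: 4 * d for d > 0, and 1 for d = 0.\<close>
  define s where "s = d + 1 + (3 * d - 1)"
  \<comment> \<open>The released potential \<open>8 * k\<close> stands on the left instead of being
    subtracted on the right; it is cancelled at the end.\<close>
  have "d + 1 + length (pd_swaps (nd h el e) v)
      + 8 * potential h E (push_down (nd h el e) v el) op + 8 * k \<le> s + 8 * P + 8 * c v"
    if v: "length v = d" for v
  proof -
    have "length (pd_swaps (nd h el e) v) \<le> 3 * d - 1"
      using length_pd_swaps_le[of "nd h el e" v] v d by (simp add: level_def)
    moreover have "potential h E (push_down (nd h el e) v el) op + k \<le> P + c v"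
      using potential_push_down_le[OF bij e, of v op] v d by (simp add: k_def P_def c_def)
    ultimately show ?thesis by (simp add: s_def)
  qed
  then have "(\<Sum>v | length v = d. d + 1 + length (pd_swaps (nd h el e) v)
      + 8 * potential h E (push_down (nd h el e) v el) op + 8 * k)
    \<le> (\<Sum>v | length v = d. s + 8 * P + 8 * c v)"
    by (intro sum_mono) auto
  also have "\<dots> = 2 ^ d * (s + 8 * P) + 4 * (2 * (\<Sum>v | length v = d. c v))"
    by (simp add: sum.distrib card_node_length algebra_simps sum_distrib_left)
  also have "\<dots> \<le> 2 ^ d * (s + 8 * P) + 4 * ((d - 2) * 2 ^ d)"
    using sum_card_pushed_le[OF bij bij_op, of d] by (simp add: c_def)
  also have "\<dots> = 2 ^ d * (s + 4 * (d - 2) + 8 * P)"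
    by (simp add: algebra_simps)
  \<comment> \<open>The weight 8 fits here: for d >= 2, \<open>s + 4 * (d - 2)\<close> equals 8 * (d
    - 1), which k >= d - \<open>level h op e\<close> - 2 matches exactly. For d = 0 and d = 1 it is
    1 and 4, against at least 8.\<close>
  also have "\<dots> \<le> 2 ^ d * (8 * (level h op e + 1) + 8 * P + 8 * k)"
    by (intro mult_left_mono) (auto simp: s_def k_def)
  also have "\<dots> = 2 ^ d * (8 * (level h op e + 1) + 8 * P) + 2 ^ d * (8 * k)"
    by (rule distrib_left)
  finally show ?thesis
    by (subst (asm) sum.distrib) (simp add: card_node_length P_def)
qed

section \<open>Expected cost of the random run\<close>

lemma total_cost_map_Swap_append:
  "total_cost h el (map Swap ps @ as) = length ps + total_cost h (fold swap_parent ps el) as"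
  by (induction ps arbitrary: el) auto

text \<open>Finite support provides integrability, used for conditioning on the first random node
  and for splitting off constants.\<close>

lemma finite_set_pmf_random_push:
  assumes "bij_betw el (tree_nodes h) E" and "set \<sigma> \<subseteq> E"
  shows "finite (set_pmf (random_push h el \<sigma>))"
  using assms
proof (induction \<sigma> arbitrary: el)
  case Nil
  then show ?case by simp
next
  case (Cons e \<sigma>)
  let ?d = "level h el e" and ?u = "nd h el e"
  have d: "?d \<le> h" using Cons.prems level_le[of el h E e] by simp
  have "finite (set_pmf (random_push h (push_down ?u v el) \<sigma>))" if "v \<in> level_nodes h ?d" for v
    using that d Cons.prems by (intro Cons.IH bij_betw_push_down) (auto simp: level_nodes_eq level_def)
  moreover have "set_pmf (pmf_of_set (level_nodes h ?d)) = level_nodes h ?d"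
    using card_node_length[of ?d] by (intro set_pmf_of_set) (auto simp: level_nodes_eq[OF d] finite_node_length intro!: Ex_list_of_length)
  ultimately show ?case
    by (simp add: level_nodes_eq[OF d] finite_node_length)
qed

lemma expectation_random_push_Cons:
  assumes bij: "bij_betw el (tree_nodes h) E" and "e \<in> E" and "set \<sigma> \<subseteq> E" and d: "d = level h el e"
  shows "measure_pmf.expectation (random_push h el (e # \<sigma>)) (\<lambda>as. real (total_cost h el as))
    = (\<Sum>v | length v = d. real (d + 1 + length (pd_swaps (nd h el e) v))
        + measure_pmf.expectation (random_push h (push_down (nd h el e) v el) \<sigma>)
            (\<lambda>as. real (total_cost h (push_down (nd h el e) v el) as))) / 2 ^ d"
proof -
  let ?u = "nd h el e"
  have dh: "d \<le> h" using assms level_le[of el h E e] by simp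
  have fin: "finite (set_pmf (random_push h (push_down ?u v el) \<sigma>))" if "length v = d" for v
    using that dh assms by (intro finite_set_pmf_random_push bij_betw_push_down) (auto simp: level_def)
  have "measure_pmf.expectation (random_push h el (e # \<sigma>)) (\<lambda>as. real (total_cost h el as))
    = (\<Sum>v | length v = d. measure_pmf.expectation
        (map_pmf (\<lambda>as. Serve e # map Swap (pd_swaps ?u v) @ as)
          (random_push h (push_down ?u v el) \<sigma>)) (\<lambda>as. real (total_cost h el as))
        /\<^sub>R real (card {v :: node. length v = d}))"
    unfolding random_push.simps d[symmetric] level_nodes_eq[OF dh]
    by (rule pmf_expectation_bind_pmf_of_set) (auto simp: finite_node_length fin intro!: Ex_list_of_length)
  also have "\<dots> = (\<Sum>v | length v = d. (real (d + 1 + length (pd_swaps ?u v))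
        + measure_pmf.expectation (random_push h (push_down ?u v el) \<sigma>)
            (\<lambda>as. real (total_cost h (push_down ?u v el) as))) / 2 ^ d)"
  proof (rule sum.cong)
    fix v :: node assume "v \<in> {v. length v = d}"
    then have "length v = d" by simp
    note int = integrable_measure_pmf_finite[OF fin[OF this]]
    show "measure_pmf.expectation
        (map_pmf (\<lambda>as. Serve e # map Swap (pd_swaps ?u v) @ as)
          (random_push h (push_down ?u v el) \<sigma>)) (\<lambda>as. real (total_cost h el as))
        /\<^sub>R real (card {v :: node. length v = d})
      = (real (d + 1 + length (pd_swaps ?u v))
        + measure_pmf.expectation (random_push h (push_down ?u v el) \<sigma>)
            (\<lambda>as. real (total_cost h (push_down ?u v el) as))) / 2 ^ d"
      by (simp add: total_cost_map_Swap_append card_node_length int d[symmetric]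
          push_down_def[symmetric] divide_inverse)
  qed simp
  finally show ?thesis by (simp add: sum_divide_distrib)
qed

text \<open>The induction runs over the offline events rather than the requests, with both
  placements arbitrary: an offline swap leaves the online side untouched, and a \<open>Serve\<close>
  triggers one random push-down. In both cases the potential absorbs what exceeds 8 times the
  offline cost.\<close>

lemma expectation_random_push_le:
  assumes "bij_betw el (tree_nodes h) E" and "bij_betw op (tree_nodes h) E"
    and "set (served as) \<subseteq> E" and "\<And>v. Swap v \<in> set as \<Longrightarrow> v \<in> tree_nodes h"
  shows "measure_pmf.expectation (random_push h el (served as)) (\<lambda>as. real (total_cost h el as))
    \<le> 8 * real (total_cost h op as) + 8 * real (potential h E el op)"
  using assms
proof (induction as arbitrary: el op)
  case Nil
  then show ?case by simp
next
  case (Cons a as)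
  show ?case
  proof (cases a)
    case (Swap v)
    then have v: "v \<in> tree_nodes h" using Cons.prems(4) by simp
    have "measure_pmf.expectation (random_push h el (served as)) (\<lambda>as. real (total_cost h el as))
        \<le> 8 * real (total_cost h (swap_parent v op) as)
          + 8 * real (potential h E el (swap_parent v op))"
      using Cons.prems Swap v by (intro Cons.IH bij_betw_swap_parent) auto
    also have "\<dots> \<le> 8 * real (total_cost h (swap_parent v op) as)
          + 8 * real (potential h E el op + 1)"
      by (intro add_left_mono mult_left_mono of_nat_mono
          potential_swap_parent_le[OF Cons.prems(2) v]) simp
    finally show ?thesis by (simp add: Swap)
  next
    case (Serve e)
    define d where "d = level h el e"
    define T where "T = 8 * real (total_cost h op as)"
    let ?u = "nd h el e"
    let ?el = "\<lambda>v. push_down ?u v el"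
    have e: "e \<in> E" and served: "set (served as) \<subseteq> E"
      using Cons.prems(3) Serve by auto
    have dh: "d \<le> h" using Cons.prems(1) e level_le by (auto simp: d_def)
    have IH: "measure_pmf.expectation (random_push h (?el v) (served as))
          (\<lambda>as. real (total_cost h (?el v) as)) \<le> T + 8 * real (potential h E (?el v) op)"
      if "length v = d" for v
      unfolding T_def using that Cons.prems Serve dh
      by (intro Cons.IH bij_betw_push_down) (auto simp: d_def level_def)
    \<comment> \<open>Scaling by \<open>2 ^ d\<close> turns the average into the plain sum of
      \<open>sum_serve_cost_le\<close>.\<close>
    have "measure_pmf.expectation (random_push h el (served (a # as)))
          (\<lambda>as. real (total_cost h el as)) * 2 ^ d
        = (\<Sum>v | length v = d. real (d + 1 + length (pd_swaps ?u v))
          + measure_pmf.expectation (random_push h (?el v) (served as))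
              (\<lambda>as. real (total_cost h (?el v) as)))"
      using expectation_random_push_Cons[OF Cons.prems(1) e served d_def]
      by (simp add: Serve del: random_push.simps)
    also have "\<dots> \<le> (\<Sum>v | length v = d. real (d + 1 + length (pd_swaps ?u v))
          + (T + 8 * real (potential h E (?el v) op)))"
      by (intro sum_mono add_left_mono IH) simp
    also have "\<dots> = real (\<Sum>v | length v = d. d + 1 + length (pd_swaps ?u v)
          + 8 * potential h E (?el v) op) + T * 2 ^ d"
      by (simp add: sum.distrib card_node_length algebra_simps)
    also have "\<dots> \<le> real (2 ^ d * (8 * (level h op e + 1) + 8 * potential h E el op)) + T * 2 ^ d"
      using sum_serve_cost_le[OF Cons.prems(1,2) e d_def] by (intro add_right_mono) (simp only: of_nat_le_iff)
    also have "\<dots> = (8 * real (total_cost h op (a # as)) + 8 * real (potential h E el op)) * 2 ^ d"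
      by (simp add: Serve T_def algebra_simps)
    finally show ?thesis by simp
  qed
qed

theorem theorem2:
  fixes h n :: nat and E :: "'e set" and el\<^sub>0 :: "node \<Rightarrow> 'e"
    and \<sigma> :: "'e list" and opt :: "'e event list"
  assumes "card (tree_nodes h) = n" and "card E = n"
    and "bij_betw el\<^sub>0 (tree_nodes h) E"
    and "set \<sigma> \<subseteq> E"
    and "offline_run h \<sigma> opt"
  shows "measure_pmf.expectation (random_push h el\<^sub>0 \<sigma>) (\<lambda>as. real (total_cost h el\<^sub>0 as))
           \<le> 16 * real (total_cost h el\<^sub>0 opt)"
proof -
  \<comment> \<open>Equal initial placements make every truncated difference 0, so no additive term
    remains.\<close>
  have "potential h E el\<^sub>0 el\<^sub>0 = 0"
    by (simp add: potential_def)
  then have "measure_pmf.expectation (random_push h el\<^sub>0 \<sigma>) (\<lambda>as. real (total_cost h el\<^sub>0 as))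
      \<le> 8 * real (total_cost h el\<^sub>0 opt)"
    using expectation_random_push_le[OF assms(3,3), of opt] assms(4,5)
    by (auto simp: offline_run_def)
  then show ?thesis by simp
qed

end
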